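(* For $\ell=1,2$ let $(\mathcal{S}_\ell,\boldsymbol{d}_{\mathcal{S}_\ell})$ be a proper Polish metric space, $p_\ell\ge1$, $\mu_\ell\in\mathcal{P}_{p_\ell}(\mathcal{S}_\ell)$, and $c_\ell(s_\ell,s_\ell')=\boldsymbol{d}_{\mathcal{S}_\ell}(s_\ell,s_\ell')^{p_\ell}$. Let $\mathcal{V}=\mathcal{S}_1\times\mathcal{S}_2$ and let $g:\mathcal{V}\to\mathbb{R}$ be measurable with $\int_{\mathcal{V}} g\,d\gamma_0>-\infty$ for some $\gamma_0\in\Pi(\mu_1,\mu_2)$. Assume further that $g$ is upper-semicontinuous and that there exist a constant $M>0$, $v^\star=(s_1^\star,s_2^\star)\in\mathcal{V}$ and $p_\ell'\in(0,p_\ell)$ for $\ell=1,2$ such that $$g(v)\le M\left[1+\boldsymbol{d}_{\mathcal{S}_1}(s_1^\star,s_1)^{p_1'}+\boldsymbol{d}_{\mathcal{S}_2}(s_2^\star,s_2)^{p_2'}\right]$$ for all $v=(s_1,s_2)\in\mathcal{V}$. Then for every $\delta\in\mathbb{R}_+^2$ an optimal solution of $$\sup_{\gamma\in\Sigma_{\mathrm{D}}(\delta)}\int_{\mathcal{V}} g\,d\gamma$$ exists, i.e. the supremum is attained by some $\gamma\in\Sigma_{\mathrm{D}}(\delta)$.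
   Context: A metric space is proper if all its closed balls are compact. $\mathcal{P}(\cdot)$ is the set of Borel probability measures; $\mathcal{P}_p(\mathcal{X})$ is the set of $\mu\in\mathcal{P}(\mathcal{X})$ with $\int\boldsymbol{d}(x_0,x)^p\,d\mu(x)<\infty$ for some (any) $x_0$; $\Pi(\mu,\nu)$ is the set of couplings; $\mathbb{R}_+^2$ is the set of vectors with nonnegative coordinates. $\boldsymbol{K}_\ell(\mu,\nu)=\inf_{\pi\in\Pi(\mu,\nu)}\int c_\ell\,d\pi$. For $\gamma\in\mathcal{P}(\mathcal{V})$, $\gamma_\ell$ is its projection on $\mathcal{S}_\ell$; $\Sigma_{\mathrm{D}}(\delta)=\{\gamma\in\mathcal{P}(\mathcal{V}):\boldsymbol{K}_1(\mu_1,\gamma_1)\le\delta_1,\ \boldsymbol{K}_2(\mu_2,\gamma_2)\le\delta_2\}$. *)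

theory Defs
  imports "HOL-Probability.Probability"
begin

definition borel_probs :: "('a::topological_space) measure set" where
  "borel_probs = {\<mu>. sets \<mu> = sets borel \<and> prob_space \<mu>}"

definition borel_probs_moment :: "real \<Rightarrow> ('a::metric_space) measure set" where
  "borel_probs_moment p =
     {\<mu> \<in> borel_probs. \<exists>x0. (\<integral>\<^sup>+ x. ennreal (dist x0 x powr p) \<partial>\<mu>) < \<infinity>}"

(* The spaces used here are second countable, so the Borel sigma-algebra of the
   product type is the product sigma-algebra (borel_prod). *)
definition couplings ::
  "('a::topological_space) measure \<Rightarrow> ('b::topological_space) measure \<Rightarrow> ('a \<times> 'b) measure set" where
  "couplings \<mu> \<nu> = {\<pi> \<in> borel_probs. distr \<pi> borel fst = \<mu> \<and> distr \<pi> borel snd = \<nu>}"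

definition transport_cost ::
  "('a \<Rightarrow> 'a \<Rightarrow> real) \<Rightarrow> ('a::topological_space) measure \<Rightarrow> 'a measure \<Rightarrow> ennreal" where
  "transport_cost c \<mu> \<nu> = (INF \<pi>\<in>couplings \<mu> \<nu>. \<integral>\<^sup>+ z. ennreal (c (fst z) (snd z)) \<partial>\<pi>)"

definition dist_cost :: "real \<Rightarrow> ('a::metric_space) \<Rightarrow> 'a \<Rightarrow> real" where
  "dist_cost p s s' = dist s s' powr p"

definition Sigma_D ::
  "('a \<Rightarrow> 'a \<Rightarrow> real) \<Rightarrow> ('b \<Rightarrow> 'b \<Rightarrow> real) \<Rightarrow>
   ('a::topological_space) measure \<Rightarrow> ('b::topological_space) measure \<Rightarrow>
   real ^ 2 \<Rightarrow> ('a \<times> 'b) measure set" where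
  "Sigma_D c1 c2 \<mu>1 \<mu>2 \<delta> = {\<gamma> \<in> borel_probs.
     transport_cost c1 \<mu>1 (distr \<gamma> borel fst) \<le> ennreal (\<delta> $ 1) \<and>
     transport_cost c2 \<mu>2 (distr \<gamma> borel snd) \<le> ennreal (\<delta> $ 2)}"

(* Extended-real Lebesgue integral: positive part minus negative part (ennreal
   truncates negative reals to 0). The Bochner integral would return 0 instead of
   an infinite value. On ereal, infinity - infinity = infinity; this case is not
   reached where the positive part of f has a finite integral. *)
definition ext_integral :: "'a measure \<Rightarrow> ('a \<Rightarrow> real) \<Rightarrow> ereal" where
  "ext_integral M f =
     enn2ereal (\<integral>\<^sup>+ x. ennreal (f x) \<partial>M) - enn2ereal (\<integral>\<^sup>+ x. ennreal (- f x) \<partial>M)"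

definition upper_semicontinuous :: "(('a::topological_space) \<Rightarrow> real) \<Rightarrow> bool" where
  "upper_semicontinuous f \<longleftrightarrow> (\<forall>x. \<forall>a > f x. \<forall>\<^sub>F y in nhds x. f y < a)"

end

theory Submission
  imports Defs
begin

text \<open>A proper separable metric space is coded into the reals by a Borel map whose integer part bounds
  the distance to a base point and whose base-3 digits record membership in a countable family of
  balls; convergence of the codes of a sequence then forces convergence of the sequence itself.
  Helly's selection theorem and Skorohod's representation theorem on the real line thus transfer to
  such spaces: a tight sequence of laws has a subsequence realised by almost surely convergent random
  variables. Optimal values are compared along such realisations by Fatou's lemma alone: bounded
  transport cost bounds the \<open>p\<close>-th moments, hence a maximizing sequence and its nearly optimal
  couplings are tight; transport costs are lower semicontinuous in the limit, and the objective is
  upper semicontinuous since \<open>g\<close> grows more slowly than the bounded moments.\<close>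

section \<open>Coding a proper metric space by real numbers\<close>

lemma base3_sum_bounds:
  fixes C :: "nat \<Rightarrow> bool"
  shows summable_base3: "summable (\<lambda>i. of_bool (C i) / 3 ^ Suc i :: real)"
    and base3_nonneg: "0 \<le> (\<Sum>i. of_bool (C i) / 3 ^ Suc i :: real)"
    and base3_le_half: "(\<Sum>i. of_bool (C i) / 3 ^ Suc i :: real) \<le> 1 / 2"
proof -
  have geo: "(\<lambda>i. 1 / 3 ^ Suc i :: real) sums (1/2)"
    using sums_mult[OF geometric_sums[of "1/3::real"], of "1/3"] by (simp add: power_one_over)
  show summ: "summable (\<lambda>i. of_bool (C i) / 3 ^ Suc i :: real)"
    by (rule summable_comparison_test_ev[OF _ sums_summable[OF geo]]) auto
  show "0 \<le> (\<Sum>i. of_bool (C i) / 3 ^ Suc i :: real)"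
    by (intro suminf_nonneg summ) auto
  have "(\<Sum>i. of_bool (C i) / 3 ^ Suc i :: real) \<le> (\<Sum>i. 1 / 3 ^ Suc i)"
    by (intro suminf_le summ sums_summable[OF geo]) auto
  then show "(\<Sum>i. of_bool (C i) / 3 ^ Suc i :: real) \<le> 1 / 2"
    using sums_unique[OF geo] by simp
qed

text \<open>Multiplication by 3^(j+1) turns the digits up to \<open>j\<close> into an integer in
  which every digit before \<open>j\<close> still carries a factor 3. The digits after
  \<open>j\<close> form the remainder; since only 0 and 1 occur in base 3, it is at most 1/2, and
  this gap below 1 makes the integer part stable under small perturbations.\<close>

lemma base3_digit:
  fixes B :: "nat \<Rightarrow> bool" and j :: nat
  defines "s \<equiv> (\<Sum>i. of_bool (B i) / 3 ^ Suc i :: real)"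
  shows "\<exists>N t. 3 ^ Suc j * s = of_int N + t \<and> N mod 3 = of_bool (B j) \<and> 0 \<le> t \<and> t \<le> 1/2"
proof -
  define N :: int where "N = (\<Sum>i<Suc j. of_bool (B i) * 3 ^ (j - i))"
  define t :: real where "t = (\<Sum>i. of_bool (B (i + Suc j)) / 3 ^ Suc i)"
  have "s = (\<Sum>i. of_bool (B (i + Suc j)) / 3 ^ Suc (i + Suc j)) + (\<Sum>i<Suc j. of_bool (B i) / 3 ^ Suc i)"
    unfolding s_def by (rule suminf_split_initial_segment[OF summable_base3])
  moreover have "3 ^ Suc j * (\<Sum>i. of_bool (B (i + Suc j)) / 3 ^ Suc (i + Suc j)) = t"
    unfolding t_def
    by (subst suminf_mult[OF summable_ignore_initial_segment[OF summable_base3, of B "Suc j"], symmetric])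
       (simp add: power_add field_simps)
  moreover have "3 ^ Suc j * (\<Sum>i<Suc j. of_bool (B i) / 3 ^ Suc i :: real) = of_int N"
  proof -
    have "3 ^ Suc j * (of_bool (B i) / 3 ^ Suc i :: real) = of_bool (B i) * 3 ^ (j - i)" if "i < Suc j" for i
      using that by (simp add: power_diff)
    then show ?thesis
      unfolding N_def sum_distrib_left by simp
  qed
  ultimately have "3 ^ Suc j * s = of_int N + t"
    by (simp only: distrib_left add.commute)
  moreover have "N mod 3 = of_bool (B j)"
  proof -
    have "3 dvd (\<Sum>i<j. of_bool (B i) * 3 ^ (j - i) :: int)"
      by (intro dvd_sum dvd_mult) auto
    then show ?thesis
      unfolding N_def by (auto simp: mod_add_eq[symmetric])
  qed
  moreover have "0 \<le> t" "t \<le> 1/2"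
    unfolding t_def by (rule base3_nonneg base3_le_half)+
  ultimately show ?thesis
    by blast
qed

text \<open>By completeness the sequence converges exactly where it is Cauchy, which is a measurable
  set; off that set the sequence is replaced by a constant, so that the limit exists everywhere. It
  supplies both the decoder of \<open>real_coding\<close> and the limit variable of
  \<open>tight_convergent_representation\<close>.\<close>

lemma borel_measurable_limit_complete:
  fixes y :: "nat \<Rightarrow> 'a \<Rightarrow> 'b::{complete_space, second_countable_topology}"
  assumes [measurable]: "\<And>k. y k \<in> borel_measurable M"
  obtains f where "f \<in> borel_measurable M"
    "\<And>x. convergent (\<lambda>k. y k x) \<Longrightarrow> (\<lambda>k. y k x) \<longlonglongrightarrow> f x"
proof
  define f where "f x = lim (\<lambda>k. if Cauchy (\<lambda>k. y k x) then y k x else undefined)" for x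
  show "f \<in> borel_measurable M"
  proof (rule borel_measurable_LIMSEQ_metric)
    have [measurable]: "Measurable.pred M (\<lambda>x. Cauchy (\<lambda>k. y k x))"
      using sets_Collect_Cauchy[of y M] by (simp add: pred_def)
    show "(\<lambda>x. if Cauchy (\<lambda>k. y k x) then y i x else undefined) \<in> borel_measurable M" for i
      by measurable
    show "(\<lambda>k. if Cauchy (\<lambda>k. y k x) then y k x else undefined) \<longlonglongrightarrow> f x" for x
      unfolding f_def
      by (cases "Cauchy (\<lambda>k. y k x)") (auto simp: Cauchy_convergent_iff convergent_LIMSEQ_iff)
  qed
  show "(\<lambda>k. y k x) \<longlonglongrightarrow> f x" if "convergent (\<lambda>k. y k x)" for x
    using that by (simp add: f_def Cauchy_convergent_iff convergent_LIMSEQ_iff)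
qed

text \<open>Neither map has to be continuous. The upper bound on \<open>h\<close> carries tightness
  over to the codes, and the last conclusion takes the place of continuity of the decoder.\<close>

lemma real_coding:
  fixes x0 :: "'v::{complete_space, second_countable_topology}"
  assumes proper: "\<forall>(x::'v) r. compact (cball x r)"
  obtains h :: "'v \<Rightarrow> real" and f :: "real \<Rightarrow> 'v"
  where "h \<in> borel_measurable borel" "f \<in> borel_measurable borel" "\<And>v. f (h v) = v"
    "\<And>v. 0 \<le> h v" "\<And>v. h v \<le> dist x0 v + 2"
    "\<And>v. convergent (\<lambda>n. h (v n)) \<Longrightarrow> convergent v"
proof -
  obtain D :: "'v set" where D: "countable D" "\<And>X. open X \<Longrightarrow> X \<noteq> {} \<Longrightarrow> \<exists>d\<in>D. d \<in> X"
    using countable_dense_setE by blast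
  have "D \<noteq> {}" using D(2)[of UNIV] by auto
  define x where "x = from_nat_into D"
  have dense: "\<exists>i. dist v (x i) < e" if e: "e > 0" for v e
  proof -
    obtain d where "d \<in> D" "d \<in> ball v e" using D(2)[OF open_ball] centre_in_ball[of v e] e by blast
    then show ?thesis
      using from_nat_into_surj[OF D(1) \<open>d \<in> D\<close>] by (auto simp: x_def)
  qed
  \<comment> \<open>One digit for each pair (i, k): does the ball about \<open>x i\<close> of radius
    1/(k+1) contain \<open>v\<close>?\<close>
  define B :: "'v \<Rightarrow> nat \<Rightarrow> bool" where
    "B v j \<longleftrightarrow> dist v (x (fst (prod_decode j))) < 1 / Suc (snd (prod_decode j))" for v j
  define s :: "'v \<Rightarrow> real" where "s v = (\<Sum>i. of_bool (B v i) / 3 ^ Suc i)" for v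
  define h :: "'v \<Rightarrow> real" where "h v = of_int \<lceil>dist x0 v\<rceil> + s v" for v
  \<comment> \<open>The added ceiling is an integer and gets multiplied by 3^(j+1), so it changes
    the integer part only by a multiple of 3.\<close>
  have digit: "\<exists>N t. 3 ^ Suc j * h v = of_int N + t \<and> N mod 3 = of_bool (B v j) \<and> 0 \<le> t \<and> t \<le> 1/2" for v j
  proof -
    obtain N t where "3 ^ Suc j * s v = of_int N + t" "N mod 3 = of_bool (B v j)" "0 \<le> t" "t \<le> 1/2"
      using base3_digit[of j "B v"] unfolding s_def by auto
    then show ?thesis
      by (intro exI[of _ "3 ^ Suc j * \<lceil>dist x0 v\<rceil> + N"] exI[of _ t])
         (auto simp: h_def distrib_left mod_add_eq[symmetric])
  qed
  have s: "0 \<le> s v" "s v \<le> 1" for v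
    using base3_nonneg[of "B v"] base3_le_half[of "B v"] by (auto simp: s_def)
  have h_nonneg: "0 \<le> h v" and h_lower: "dist x0 v \<le> h v" and h_upper: "h v \<le> dist x0 v + 2" for v
  proof -
    have "dist x0 v \<le> of_int \<lceil>dist x0 v\<rceil>" "of_int \<lceil>dist x0 v\<rceil> \<le> dist x0 v + 1"
      by linarith+
    then show "dist x0 v \<le> h v" "h v \<le> dist x0 v + 2"
      unfolding h_def using s[of v] by linarith+
    then show "0 \<le> h v" using zero_le_dist[of x0 v] by linarith
  qed
  have h_meas: "h \<in> borel_measurable borel"
    unfolding h_def s_def B_def by measurable
  have digit_floor: "B v j \<longleftrightarrow> \<lfloor>3 ^ Suc j * h v\<rfloor> mod 3 = 1" for v j
  proof -
    obtain N t where N: "3 ^ Suc j * h v = of_int N + t" "N mod 3 = of_bool (B v j)" "0 \<le> t" "t \<le> 1/2"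
      using digit by blast
    have "\<lfloor>3 ^ Suc j * h v\<rfloor> = N" using N by (intro floor_unique) auto
    then show ?thesis using N(2) by auto
  qed
  \<comment> \<open>Decoding to precision 1/(k+1): the first centre whose ball contains the point.
    At a real number that is not a code, \<open>LEAST\<close> may be meaningless; only the values at
    codes matter.\<close>
  define y where "y k r = x (LEAST i. \<lfloor>3 ^ Suc (prod_encode (i, k)) * r\<rfloor> mod 3 = 1)" for k :: nat and r :: real
  have y_meas: "y k \<in> borel_measurable borel" for k
    unfolding y_def by measurable
  obtain f where f_meas: "f \<in> borel_measurable borel"
    and f_lim: "\<And>r. convergent (\<lambda>k. y k r) \<Longrightarrow> (\<lambda>k. y k r) \<longlonglongrightarrow> f r"
    using borel_measurable_limit_complete[of y borel] y_meas by blast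
  have f_h: "f (h v) = v" for v
  proof -
    have "dist (y k (h v)) v < 1 / Suc k" for k
    proof -
      define l where "l = (LEAST i. B v (prod_encode (i, k)))"
      have "\<exists>i. B v (prod_encode (i, k))"
        using dense[of "1 / Suc k" v] by (simp add: B_def)
      then have "B v (prod_encode (l, k))"
        unfolding l_def by (rule LeastI_ex)
      moreover have "y k (h v) = x l" unfolding y_def l_def digit_floor ..
      ultimately show ?thesis by (simp add: B_def dist_commute)
    qed
    then have "(\<lambda>k. dist (y k (h v)) v) \<longlonglongrightarrow> 0"
      by (intro real_tendsto_sandwich[OF _ _ tendsto_const LIMSEQ_inverse_real_of_nat])
         (auto simp: inverse_eq_divide intro!: always_eventually less_imp_le)
    then have *: "(\<lambda>k. y k (h v)) \<longlonglongrightarrow> v" by (rule tendsto_dist_iff[THEN iffD2])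
    show ?thesis by (rule LIMSEQ_unique[OF f_lim[OF convergentI[OF *]] *])
  qed
  have conv: "convergent v" if "convergent (\<lambda>n. h (v n))" for v
  proof -
    \<comment> \<open>Bounded codes confine the points to a closed ball, which is compact by
      properness. This gives a cluster point \<open>a\<close>; the digits then show that the whole
      sequence converges to it.\<close>
    from that have "Bseq (\<lambda>n. h (v n))" by (rule convergent_imp_Bseq)
    then obtain K where K: "\<And>n. norm (h (v n)) \<le> K" by (auto simp: Bseq_def)
    have "v n \<in> cball x0 K" for n using h_lower[of "v n"] K[of n] by auto
    moreover have "seq_compact (cball x0 K)" using proper compact_imp_seq_compact by blast
    ultimately obtain a r where r: "strict_mono r" "(v \<circ> r) \<longlonglongrightarrow> a"
      unfolding seq_compact_def by blast
    \<comment> \<open>Each scaled code has fractional part in \<open>[0, 1/2]\<close>, so close codes share their digits.\<close>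
    have const: "\<exists>n0. \<forall>n\<ge>n0. \<forall>m\<ge>n0. B (v n) j = B (v m) j" for j
    proof -
      have "Cauchy (\<lambda>n. 3 ^ Suc j * h (v n))"
        using that convergent_mult[OF convergent_const] convergent_Cauchy by blast
      then obtain n0 where n0: "\<And>n m. n \<ge> n0 \<Longrightarrow> m \<ge> n0 \<Longrightarrow> \<bar>3 ^ Suc j * h (v n) - 3 ^ Suc j * h (v m)\<bar> < 1/2"
        unfolding Cauchy_iff real_norm_def by (meson half_gt_zero zero_less_one)
      have "B (v n) j = B (v m) j" if "n \<ge> n0" "m \<ge> n0" for n m
      proof -
        obtain N t where N: "3 ^ Suc j * h (v n) = of_int N + t" "N mod 3 = of_bool (B (v n) j)" "0 \<le> t" "t \<le> 1/2"
          using digit by blast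
        obtain N' t' where N': "3 ^ Suc j * h (v m) = of_int N' + t'" "N' mod 3 = of_bool (B (v m) j)" "0 \<le> t'" "t' \<le> 1/2"
          using digit by blast
        have "\<bar>of_int N + t - (of_int N' + t')\<bar> < (1/2::real)"
          using n0[OF that] N(1) N'(1) by simp
        then have "N = N'" using N(3,4) N'(3,4) by linarith
        then show ?thesis using N(2) N'(2) by (auto split: if_splits simp: of_bool_def)
      qed
      then show ?thesis by blast
    qed
    have "v \<longlonglongrightarrow> a"
      unfolding lim_sequentially
    proof (intro allI impI)
      fix e :: real assume "e > 0"
      then obtain k where k: "1 / Suc k < e / 2" using nat_approx_posE[of "e/2"] by auto
      \<comment> \<open>The digit of a ball containing \<open>a\<close> is 1 far out along the
        subsequence, because the ball is open. Being eventually constant, it is 1 along the whole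
        sequence from some index on, so \<open>v n\<close> and \<open>a\<close> share a ball of
        radius below e/2.\<close>
      obtain i where i: "dist a (x i) < 1 / Suc k" using dense[of "1 / Suc k" a] by auto
      define j where "j = prod_encode (i, k)"
      have Bj: "B w j \<longleftrightarrow> dist w (x i) < 1 / Suc k" for w by (simp add: B_def j_def)
      obtain n0 where n0: "\<And>n m. n \<ge> n0 \<Longrightarrow> m \<ge> n0 \<Longrightarrow> B (v n) j = B (v m) j"
        using const[of j] by blast
      have "(\<lambda>n. dist ((v \<circ> r) n) (x i)) \<longlonglongrightarrow> dist a (x i)"
        by (intro tendsto_intros r)
      then have "\<forall>\<^sub>F n in sequentially. dist ((v \<circ> r) n) (x i) < 1 / Suc k"
        using i by (rule order_tendstoD)
      then obtain n1 where n1: "\<And>n. n \<ge> n1 \<Longrightarrow> B (v (r n)) j"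
        unfolding eventually_sequentially Bj by auto
      have "B (v n) j" if "n \<ge> n0" for n
        using n0[OF that, of "r (max n0 n1)"] n1[of "max n0 n1"] seq_suble[OF r(1), of "max n0 n1"]
        by auto
      then have "dist (v n) a < e" if "n \<ge> n0" for n
        using that i k dist_triangle2[of "v n" a "x i"] by (fastforce simp: Bj)
      then show "\<exists>n0. \<forall>n\<ge>n0. dist (v n) a < e" by blast
    qed
    then show ?thesis by (rule convergentI)
  qed
  show thesis
    by (rule that[OF h_meas f_meas f_h h_nonneg h_upper conv])
qed

section \<open>Almost surely convergent representations\<close>

lemma borel_probsD:
  assumes "\<mu> \<in> borel_probs"
  shows "sets \<mu> = sets borel" "space \<mu> = UNIV" "prob_space \<mu>"
  using assms sets_eq_imp_space_eq[of \<mu> borel] by (auto simp: borel_probs_def)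

lemma distr_in_borel_probs:
  "prob_space M \<Longrightarrow> X \<in> borel_measurable M \<Longrightarrow> distr M borel X \<in> borel_probs"
  by (auto simp: borel_probs_def intro: prob_space.prob_space_distr)

text \<open>The laws are pushed to the real line by \<open>h\<close>, where tightness gives a weakly
  convergent subsequence and Skorohod's theorem realises it by random variables \<open>Z n\<close>;
  decoding these by \<open>f\<close> recovers the original laws.\<close>

lemma tight_convergent_representation:
  fixes \<nu> :: "nat \<Rightarrow> 'v::{complete_space, second_countable_topology} measure"
  assumes proper: "\<forall>(x::'v) r. compact (cball x r)"
    and \<nu>: "\<And>n. \<nu> n \<in> borel_probs"
    and tight: "\<And>e. e > 0 \<Longrightarrow> \<exists>r. \<forall>n. measure (\<nu> n) (cball a r) > 1 - e"
  obtains r :: "nat \<Rightarrow> nat" and \<Omega> :: "real measure" and X Y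
  where "strict_mono r" "prob_space \<Omega>" "\<And>n. X n \<in> borel_measurable \<Omega>" "Y \<in> borel_measurable \<Omega>"
    "\<And>n. distr \<Omega> borel (X n) = \<nu> (r n)" "AE \<omega> in \<Omega>. (\<lambda>n. X n \<omega>) \<longlonglongrightarrow> Y \<omega>"
proof -
  obtain h :: "'v \<Rightarrow> real" and f :: "real \<Rightarrow> 'v"
    where h[measurable]: "h \<in> borel_measurable borel" and f[measurable]: "f \<in> borel_measurable borel"
      and fh: "\<And>v. f (h v) = v" and h_bounds: "\<And>v. 0 \<le> h v" "\<And>v. h v \<le> dist a v + 2"
      and h_conv: "\<And>v. convergent (\<lambda>n. h (v n)) \<Longrightarrow> convergent v"
    using real_coding[OF proper, of a] by blast
  note sets_\<nu>[measurable_cong] = borel_probsD(1)[OF \<nu>]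
  define \<mu> where "\<mu> n = distr (\<nu> n) borel h" for n
  have \<mu>: "real_distribution (\<mu> n)" for n
    using prob_space.real_distribution_distr[OF borel_probsD(3)[OF \<nu>]] by (simp add: \<mu>_def)
  have "tight \<mu>"
    unfolding tight_def
  proof (intro conjI allI impI \<mu>)
    fix e :: real assume "e > 0"
    then obtain r where r: "\<And>n. measure (\<nu> n) (cball a r) > 1 - e" using tight by blast
    \<comment> \<open>Codes start at 0, so the left end of the half-open interval is -1; the 2 is
      the slack in the upper bound on \<open>h\<close>, and the absolute value keeps the interval
      nonempty for negative \<open>r\<close>.\<close>
    have "measure (\<nu> n) (cball a r) \<le> measure (\<mu> n) {-1<..\<bar>r\<bar> + 2}" for n
    proof -
      interpret prob_space "\<nu> n" by (rule borel_probsD[OF \<nu>])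
      have "cball a r \<subseteq> h -` {-1<..\<bar>r\<bar> + 2} \<inter> space (\<nu> n)"
      proof
        fix v assume "v \<in> cball a r"
        then show "v \<in> h -` {-1<..\<bar>r\<bar> + 2} \<inter> space (\<nu> n)"
          using h_bounds[of v] by (auto simp: borel_probsD(2)[OF \<nu>])
      qed
      then have "measure (\<nu> n) (cball a r) \<le> measure (\<nu> n) (h -` {-1<..\<bar>r\<bar> + 2} \<inter> space (\<nu> n))"
        by (intro finite_measure_mono) measurable
      then show ?thesis by (simp add: \<mu>_def measure_distr)
    qed
    then show "\<exists>a b. a < b \<and> (\<forall>n. 1 - e < measure (\<mu> n) {a<..b})"
      using r by (intro exI[of _ "-1"] exI[of _ "\<bar>r\<bar> + 2"]) (auto intro: less_le_trans)
  qed
  then obtain r M where r: "strict_mono (r :: nat \<Rightarrow> nat)" and M: "real_distribution M"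
    and "weak_conv_m (\<mu> \<circ> id \<circ> r) M"
    using tight_imp_convergent_subsubsequence[of \<mu> id] by (auto simp: strict_mono_def)
  then have "weak_conv_m (\<lambda>n. \<mu> (r n)) M" by (simp add: comp_def)
  from Skorohod[OF \<mu> M this] obtain \<Omega> :: "real measure" and Z Z'
    where "prob_space \<Omega>" and Z[measurable]: "\<And>n. Z n \<in> borel_measurable \<Omega>"
      and Z_law: "\<And>n. distr \<Omega> borel (Z n) = \<mu> (r n)"
      and Z_lim: "\<And>\<omega>. \<omega> \<in> space \<Omega> \<Longrightarrow> (\<lambda>n. Z n \<omega>) \<longlonglongrightarrow> Z' \<omega>"
    by blast
  define X where "X n \<omega> = f (Z n \<omega>)" for n \<omega>
  have X[measurable]: "X n \<in> borel_measurable \<Omega>" for n unfolding X_def by measurable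
  have X_law: "distr \<Omega> borel (X n) = \<nu> (r n)" for n
  proof -
    have "distr \<Omega> borel (X n) = distr (distr \<Omega> borel (Z n)) borel f"
      by (simp add: distr_distr comp_def X_def[abs_def])
    also have "\<dots> = distr (\<nu> (r n)) borel (f \<circ> h)"
      unfolding Z_law \<mu>_def by (rule distr_distr) measurable
    also have "\<dots> = \<nu> (r n)"
      using fh by (simp add: comp_def distr_id2 borel_probsD[OF \<nu>])
    finally show ?thesis .
  qed
  \<comment> \<open>The law of \<open>Z n\<close> is an image under \<open>h\<close>, so
    \<open>Z n\<close> is almost surely a code, and on codes \<open>h\<close> undoes
    \<open>f\<close>.\<close>
  have "AE \<omega> in \<Omega>. h (X n \<omega>) = Z n \<omega>" for n
  proof -
    have "AE z in \<mu> (r n). h (f z) = z"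
      unfolding \<mu>_def by (subst AE_distr_iff) (auto simp: fh)
    then show ?thesis
      unfolding Z_law[symmetric] X_def by (subst (asm) AE_distr_iff) auto
  qed
  then have "AE \<omega> in \<Omega>. \<forall>n. h (X n \<omega>) = Z n \<omega>" by (simp add: AE_all_countable)
  then have X_conv: "AE \<omega> in \<Omega>. convergent (\<lambda>n. X n \<omega>)"
    using AE_space by eventually_elim (rule h_conv, use Z_lim in \<open>auto simp: convergent_def\<close>)
  \<comment> \<open>\<open>f\<close> need not be continuous and \<open>Z'\<close> need not be a
    code, so \<open>f\<close> applied to \<open>Z'\<close> is no candidate for the limit.
    \<open>Y\<close> is instead a pointwise limit of the \<open>X n\<close>, which converge because
    their codes do.\<close>
  obtain Y where Y: "Y \<in> borel_measurable \<Omega>"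
    and Y_lim: "\<And>\<omega>. convergent (\<lambda>n. X n \<omega>) \<Longrightarrow> (\<lambda>n. X n \<omega>) \<longlonglongrightarrow> Y \<omega>"
    using borel_measurable_limit_complete[of X \<Omega>] X by blast
  have "AE \<omega> in \<Omega>. (\<lambda>n. X n \<omega>) \<longlonglongrightarrow> Y \<omega>"
    using X_conv by eventually_elim (rule Y_lim)
  then show thesis
    by (rule that[OF r \<open>prob_space \<Omega>\<close> X Y X_law])
qed

text \<open>Dominated convergence gives equal integrals of continuous functions with values in
  [0, 1]; these determine the measure of open sets, a generating family stable under intersection.
  The two sequences may live on different probability spaces, which is what identifying the
  marginals of a limit coupling requires.\<close>

lemma law_limit_unique:
  fixes X :: "nat \<Rightarrow> 'a \<Rightarrow> 'v::metric_space" and X' :: "nat \<Rightarrow> 'b \<Rightarrow> 'v"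
  assumes "prob_space M" "prob_space M'"
    and [measurable]: "\<And>n. X n \<in> borel_measurable M" "Y \<in> borel_measurable M"
    and [measurable]: "\<And>n. X' n \<in> borel_measurable M'" "Y' \<in> borel_measurable M'"
    and law: "\<And>n. distr M borel (X n) = distr M' borel (X' n)"
    and lim: "AE x in M. (\<lambda>n. X n x) \<longlonglongrightarrow> Y x" and lim': "AE x in M'. (\<lambda>n. X' n x) \<longlonglongrightarrow> Y' x"
  shows "distr M borel Y = distr M' borel Y'"
proof -
  interpret M: prob_space M by fact
  interpret M': prob_space M' by fact
  have cont_eq: "(\<integral>\<^sup>+x. ennreal (\<phi> x) \<partial>distr M borel Y) = (\<integral>\<^sup>+x. ennreal (\<phi> x) \<partial>distr M' borel Y')"
    if \<phi>: "continuous_on UNIV \<phi>" and le1: "\<And>x. \<phi> x \<le> 1" for \<phi> :: "'v \<Rightarrow> real"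
  proof -
    have [measurable]: "\<phi> \<in> borel_measurable borel" by (rule borel_measurable_continuous_onI[OF \<phi>])
    have c: "(\<lambda>n. ennreal (\<phi> (u n))) \<longlonglongrightarrow> ennreal (\<phi> l)" if "u \<longlonglongrightarrow> l" for u l
      by (intro tendsto_ennrealI continuous_on_tendsto_compose[OF \<phi> that]) auto
    have 1: "(\<lambda>n. \<integral>\<^sup>+x. ennreal (\<phi> (X n x)) \<partial>M) \<longlonglongrightarrow> (\<integral>\<^sup>+x. ennreal (\<phi> (Y x)) \<partial>M)"
      by (rule nn_integral_dominated_convergence[where w="\<lambda>_. 1"])
         (use lim in \<open>auto simp: le1 M.emeasure_space_1 intro: c\<close>)
    have 2: "(\<lambda>n. \<integral>\<^sup>+x. ennreal (\<phi> (X' n x)) \<partial>M') \<longlonglongrightarrow> (\<integral>\<^sup>+x. ennreal (\<phi> (Y' x)) \<partial>M')"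
      by (rule nn_integral_dominated_convergence[where w="\<lambda>_. 1"])
         (use lim' in \<open>auto simp: le1 M'.emeasure_space_1 intro: c\<close>)
    have "(\<integral>\<^sup>+x. ennreal (\<phi> (X n x)) \<partial>M) = (\<integral>\<^sup>+x. ennreal (\<phi> (X' n x)) \<partial>M')" for n
      using arg_cong[OF law[of n], of "\<lambda>N. \<integral>\<^sup>+x. ennreal (\<phi> x) \<partial>N"]
      by (simp add: nn_integral_distr)
    then show ?thesis using LIMSEQ_unique[OF 1] 2 by (simp add: nn_integral_distr)
  qed
  have open_eq: "emeasure (distr M borel Y) U = emeasure (distr M' borel Y') U" if "open U" for U
  \<comment> \<open>\<open>infdist\<close> to the empty set is 0 by convention, so the test
    functions below would vanish for the whole space.\<close>
  proof (cases "U = UNIV")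
    case True
    then show ?thesis by (simp add: emeasure_distr M.emeasure_space_1 M'.emeasure_space_1)
  next
    case False
    define \<phi> where "\<phi> k x = min 1 (real k * infdist x (- U))" for k x
    have inf0: "infdist x (- U) = 0 \<longleftrightarrow> x \<notin> U" for x
      using in_closed_iff_infdist_zero[of "- U" x] that False by auto
    have \<phi>_lim: "(\<lambda>k. ennreal (\<phi> k x)) \<longlonglongrightarrow> indicator U x" for x
    proof (cases "x \<in> U")
      case True
      then have pos: "infdist x (- U) > 0"
        using inf0[of x] infdist_nonneg[of x "- U"] by linarith
      then obtain k where k: "1 < real k * infdist x (- U)" by (rule reals_Archimedean3[rule_format, THEN exE])
      have "\<phi> j x = 1" if "j \<ge> k" for j
      proof -
        have "real k * infdist x (- U) \<le> real j * infdist x (- U)"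
          using that pos by (intro mult_right_mono) auto
        then show ?thesis using k by (simp add: \<phi>_def)
      qed
      then have "\<forall>\<^sub>F k in sequentially. ennreal (\<phi> k x) = indicator U x"
        using True by (auto simp: eventually_sequentially)
      then show ?thesis by (rule tendsto_eventually)
    next
      case False
      then show ?thesis using inf0[of x] by (simp add: \<phi>_def)
    qed
    have cont: "continuous_on UNIV (\<phi> k)" for k
      unfolding \<phi>_def by (intro continuous_intros)
    have [measurable]: "\<phi> k \<in> borel_measurable borel" for k
      by (rule borel_measurable_continuous_onI[OF cont])
    have 3: "(\<lambda>k. \<integral>\<^sup>+x. ennreal (\<phi> k x) \<partial>N) \<longlonglongrightarrow> emeasure N U"
      if N: "prob_space N" "sets N = sets borel" for N
    proof -
      interpret N: prob_space N by fact
      note N(2)[measurable_cong]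
      have [measurable]: "U \<in> sets borel" using \<open>open U\<close> by auto
      have "(\<lambda>k. \<integral>\<^sup>+x. ennreal (\<phi> k x) \<partial>N) \<longlonglongrightarrow> (\<integral>\<^sup>+x. indicator U x \<partial>N)"
        by (rule nn_integral_dominated_convergence[where w="\<lambda>_. 1"])
           (auto simp: N.emeasure_space_1 \<phi>_def[symmetric] intro!: \<phi>_lim, auto simp: \<phi>_def)
      then show ?thesis by (simp add: N)
    qed
    have "(\<integral>\<^sup>+x. ennreal (\<phi> k x) \<partial>distr M borel Y) = (\<integral>\<^sup>+x. ennreal (\<phi> k x) \<partial>distr M' borel Y')" for k
      by (rule cont_eq[OF cont]) (simp add: \<phi>_def)
    then show ?thesis
      using LIMSEQ_unique[OF 3[of "distr M borel Y"], of "emeasure (distr M' borel Y') U"] 3[of "distr M' borel Y'"]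
      by (simp add: M.prob_space_distr M'.prob_space_distr)
  qed
  show ?thesis
  proof (rule measure_eqI_generator_eq[where E="{S. open S}" and \<Omega>=UNIV and A="\<lambda>_. UNIV"])
    show "emeasure (distr M borel Y) UNIV \<noteq> \<infinity>"
      by (simp add: emeasure_distr M.emeasure_space_1)
  qed (auto simp: Int_stable_def sets_borel intro: open_eq)
qed

section \<open>Moments and transport costs\<close>

lemma borel_measurable_fst_snd [measurable]:
  "fst \<in> borel_measurable (borel :: ('a::topological_space \<times> 'b::topological_space) measure)"
  "snd \<in> borel_measurable (borel :: ('a::topological_space \<times> 'b::topological_space) measure)"
  by (intro borel_measurable_continuous_onI continuous_intros)+

lemma compact_cball_prod:
  fixes z :: "'a::metric_space \<times> 'b::metric_space"
  assumes "\<forall>(x::'a) r. compact (cball x r)" "\<forall>(x::'b) r. compact (cball x r)"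
  shows "compact (cball z r)"
proof -
  have "cball z r \<subseteq> cball (fst z) r \<times> cball (snd z) r"
    using order_trans[OF dist_fst_le[of z]] order_trans[OF dist_snd_le[of z]]
    by (force simp: mem_Times_iff)
  then have "cball z r = (cball (fst z) r \<times> cball (snd z) r) \<inter> cball z r" by blast
  also have "compact \<dots>"
    by (intro compact_Int_closed compact_Times closed_cball) (use assms in auto)
  finally show ?thesis .
qed

lemma powr_dist_triangle:
  assumes "p > 0"
  shows "dist x z powr p \<le> 2 powr p * (dist x y powr p + dist y z powr p)"
proof -
  have "dist x z \<le> 2 * max (dist x y) (dist y z)"
    using dist_triangle[of x z y] by linarith
  then have "dist x z powr p \<le> (2 * max (dist x y) (dist y z)) powr p"
    using assms by (intro powr_mono2) auto
  also have "\<dots> = 2 powr p * max (dist x y) (dist y z) powr p"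
    by (rule powr_mult)
  also have "\<dots> \<le> 2 powr p * (dist x y powr p + dist y z powr p)"
    by (intro mult_left_mono) (auto simp: max_def)
  finally show ?thesis .
qed

lemma ennreal_powr_dist_triangle:
  assumes "p > 0"
  shows "ennreal (dist x z powr p) \<le> ennreal (2 powr p) * (ennreal (dist x y powr p) + ennreal (dist y z powr p))"
  using ennreal_leI[OF powr_dist_triangle[OF assms, of x z y]] by (simp add: ennreal_mult)

lemma le_one_plus_powr:
  fixes t :: real
  assumes "0 \<le> t" "1 \<le> p"
  shows "t \<le> 1 + t powr p"
proof (cases "t \<le> 1")
  case False
  then have "t powr 1 \<le> t powr p" using assms by (intro powr_mono) auto
  then show ?thesis using False by simp
qed (use powr_ge_zero[of t p] in linarith)

lemma continuous_on_dist_powr [continuous_intros]: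
  assumes "p > 0" "continuous_on A f" "continuous_on A g"
  shows "continuous_on A (\<lambda>x. dist (f x) (g x) powr p)"
  using assms by (intro continuous_on_powr') (auto intro!: continuous_intros)

text \<open>This is where the strict gap between the growth exponents of \<open>g\<close> and the
  moment exponents enters: the smaller power costs only an arbitrarily small multiple of the larger
  one, plus a constant.\<close>

lemma powr_le_eps:
  fixes t :: real
  assumes "0 < q" "q < p" "0 < e" "0 \<le> t"
  shows "t powr q \<le> e powr (- q / (p - q)) + e * t powr p"
proof -
  \<comment> \<open>\<open>T\<close> solves t^q = e * t^p. Up to \<open>T\<close> the constant T^q
    suffices; beyond it the term e * t^p dominates.\<close>
  define T where "T = e powr (- 1 / (p - q))"
  have "T > 0" using assms by (simp add: T_def)
  show ?thesis
  proof (cases "t \<le> T")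
    case True
    then have "t powr q \<le> T powr q" using assms by (intro powr_mono2) auto
    also have "T powr q = e powr (- q / (p - q))" by (simp add: T_def powr_powr)
    finally show ?thesis using assms by (simp add: add_increasing2)
  next
    case False
    then have "t > 0" using \<open>T > 0\<close> by linarith
    have "t powr (q - p) \<le> T powr (q - p)"
      using False \<open>T > 0\<close> assms by (intro powr_mono2') auto
    also have "\<dots> = e"
    proof -
      have "- 1 / (p - q) * (q - p) = 1" using assms by (simp add: field_simps)
      then show ?thesis using assms by (simp only: T_def powr_powr powr_one)
    qed
    finally have "t powr (q - p) * t powr p \<le> e * t powr p"
      by (intro mult_right_mono) auto
    then have "t powr q \<le> e * t powr p" by (simp add: powr_add[symmetric])
    then show ?thesis using powr_ge_zero[of e "- q / (p - q)"] by linarith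
  qed
qed

lemma tight_if_first_moments_bounded:
  fixes \<nu> :: "nat \<Rightarrow> 'v::metric_space measure"
  assumes \<nu>: "\<And>n. \<nu> n \<in> borel_probs"
    and bound: "\<And>n. (\<integral>\<^sup>+v. ennreal (dist x0 v) \<partial>\<nu> n) \<le> C" "C < \<infinity>"
    and "e > 0"
  shows "\<exists>r. \<forall>n. measure (\<nu> n) (cball x0 r) > 1 - e"
proof -
  obtain c where c: "C = ennreal c" "0 \<le> c" using bound(2) by (cases C) auto
  \<comment> \<open>Markov's inequality bounds the mass outside the ball by c/r; the extra 1 makes
    this strictly less than \<open>e\<close> and keeps \<open>r\<close> positive when
    \<open>c\<close> is 0.\<close>
  define r where "r = (c + 1) / e"
  have "r > 0" using c \<open>e > 0\<close> by (simp add: r_def)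
  have "measure (\<nu> n) (cball x0 r) > 1 - e" for n
  proof -
    interpret prob_space "\<nu> n" by (rule borel_probsD[OF \<nu>])
    note borel_probsD(1)[OF \<nu>, of n, measurable_cong]
    have [measurable]: "dist x0 \<in> borel_measurable borel"
      by (intro borel_measurable_continuous_onI continuous_intros)
    have sp: "space (\<nu> n) = UNIV" by (rule borel_probsD[OF \<nu>])
    have "emeasure (\<nu> n) {v \<in> UNIV. 1 \<le> ennreal (1 / r) * ennreal (dist x0 v)}
        \<le> ennreal (1 / r) * (\<integral>\<^sup>+v. ennreal (dist x0 v) * indicator UNIV v \<partial>\<nu> n)"
      by (rule nn_integral_Markov_inequality) measurable
    also have "\<dots> \<le> ennreal (1 / r) * C"
      using bound(1)[of n] by (intro mult_left_mono) (auto simp: sp)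
    also have "\<dots> = ennreal (c / r)" using c \<open>r > 0\<close> by (simp add: ennreal_mult[symmetric])
    finally have 1: "emeasure (\<nu> n) {v \<in> UNIV. 1 \<le> ennreal (1 / r) * ennreal (dist x0 v)} \<le> ennreal (c / r)" .
    have "- cball x0 r \<subseteq> {v \<in> UNIV. 1 \<le> ennreal (1 / r) * ennreal (dist x0 v)}"
      using \<open>r > 0\<close> by (auto simp: sp ennreal_mult[symmetric] field_simps)
    then have "emeasure (\<nu> n) (- cball x0 r) \<le> ennreal (c / r)"
      by (intro order_trans[OF emeasure_mono 1]) measurable
    then have "measure (\<nu> n) (- cball x0 r) \<le> c / r"
      using c \<open>r > 0\<close> by (simp add: emeasure_eq_measure)
    moreover have "c / r < e"
      using c \<open>e > 0\<close> by (simp add: r_def field_simps)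
    moreover have "measure (\<nu> n) (- cball x0 r) = 1 - measure (\<nu> n) (cball x0 r)"
      using prob_compl[of "cball x0 r"] by (simp add: sp borel_probsD(1)[OF \<nu>] Compl_eq_Diff_UNIV)
    ultimately show ?thesis by simp
  qed
  then show ?thesis by blast
qed

text \<open>The bound involves only the marginals, so it holds uniformly over all couplings of given
  laws. Each coordinate contributes 1 to the constant through t <= 1 + t^p.\<close>

lemma first_moment_prod_le:
  fixes \<pi> :: "('a::{metric_space, second_countable_topology} \<times> 'b::{metric_space, second_countable_topology}) measure"
  assumes \<pi>: "\<pi> \<in> borel_probs" and p: "1 \<le> p" "1 \<le> q"
  shows "(\<integral>\<^sup>+z. ennreal (dist (x0, y0) z) \<partial>\<pi>) \<le>
    2 + ((\<integral>\<^sup>+x. ennreal (dist x0 x powr p) \<partial>distr \<pi> borel fst) + (\<integral>\<^sup>+y. ennreal (dist y0 y powr q) \<partial>distr \<pi> borel snd))"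
proof -
  interpret prob_space \<pi> by (rule borel_probsD[OF \<pi>])
  note borel_probsD(1)[OF \<pi>, measurable_cong]
  have "dist (x0, y0) z \<le> 2 + (dist x0 (fst z) powr p + dist y0 (snd z) powr q)" for z
  proof -
    have "dist (x0, y0) z \<le> dist x0 (fst z) + dist y0 (snd z)"
      by (cases z) (simp add: dist_Pair_Pair sqrt_sum_squares_le_sum)
    then show ?thesis
      using le_one_plus_powr[of "dist x0 (fst z)" p] le_one_plus_powr[of "dist y0 (snd z)" q] p by simp
  qed
  then have "(\<integral>\<^sup>+z. ennreal (dist (x0, y0) z) \<partial>\<pi>) \<le>
      (\<integral>\<^sup>+z. 2 + (ennreal (dist x0 (fst z) powr p) + ennreal (dist y0 (snd z) powr q)) \<partial>\<pi>)"
    by (intro nn_integral_mono) (simp add: ennreal_plus[symmetric] del: ennreal_plus flip: ennreal_numeral)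
  also have "\<dots> = 2 + ((\<integral>\<^sup>+z. ennreal (dist x0 (fst z) powr p) \<partial>\<pi>) + (\<integral>\<^sup>+z. ennreal (dist y0 (snd z) powr q) \<partial>\<pi>))"
    by (simp add: nn_integral_add emeasure_space_1)
  finally show ?thesis by (simp add: nn_integral_distr)
qed

lemma transport_cost_less_obtains:
  assumes "transport_cost c \<mu> \<nu> < t"
  obtains \<pi> where "\<pi> \<in> couplings \<mu> \<nu>" "(\<integral>\<^sup>+ z. ennreal (c (fst z) (snd z)) \<partial>\<pi>) < t"
  using assms unfolding transport_cost_def by (auto simp: INF_less_iff)

lemma moment_le_of_transport_cost:
  fixes \<mu> \<nu> :: "'a::{metric_space, second_countable_topology} measure"
  assumes "p > 0" and cost: "transport_cost (dist_cost p) \<mu> \<nu> < t"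
  shows "(\<integral>\<^sup>+y. ennreal (dist x0 y powr p) \<partial>\<nu>) \<le>
    ennreal (2 powr p) * ((\<integral>\<^sup>+x. ennreal (dist x0 x powr p) \<partial>\<mu>) + t)"
proof -
  obtain \<pi> where \<pi>: "\<pi> \<in> couplings \<mu> \<nu>" and c: "(\<integral>\<^sup>+ z. ennreal (dist_cost p (fst z) (snd z)) \<partial>\<pi>) < t"
    by (rule transport_cost_less_obtains[OF cost])
  then have \<pi>': "\<pi> \<in> borel_probs" "distr \<pi> borel fst = \<mu>" "distr \<pi> borel snd = \<nu>"
    by (auto simp: couplings_def)
  note borel_probsD(1)[OF \<pi>'(1), measurable_cong]
  have [measurable]: "(\<lambda>z::'a\<times>'a. dist (fst z) (snd z) powr p) \<in> borel_measurable borel"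
    using \<open>p > 0\<close> by (intro borel_measurable_continuous_onI continuous_intros)
  have "(\<integral>\<^sup>+y. ennreal (dist x0 y powr p) \<partial>\<nu>) = (\<integral>\<^sup>+z. ennreal (dist x0 (snd z) powr p) \<partial>\<pi>)"
    unfolding \<pi>'(3)[symmetric] by (simp add: nn_integral_distr)
  also have "\<dots> \<le> (\<integral>\<^sup>+z. ennreal (2 powr p) * (ennreal (dist x0 (fst z) powr p) + ennreal (dist_cost p (fst z) (snd z))) \<partial>\<pi>)"
    unfolding dist_cost_def by (intro nn_integral_mono ennreal_powr_dist_triangle \<open>p > 0\<close>)
  also have "\<dots> = ennreal (2 powr p) * ((\<integral>\<^sup>+z. ennreal (dist x0 (fst z) powr p) \<partial>\<pi>) + (\<integral>\<^sup>+ z. ennreal (dist_cost p (fst z) (snd z)) \<partial>\<pi>))"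
    unfolding dist_cost_def by (simp add: nn_integral_cmult nn_integral_add)
  also have "(\<integral>\<^sup>+z. ennreal (dist x0 (fst z) powr p) \<partial>\<pi>) = (\<integral>\<^sup>+x. ennreal (dist x0 x powr p) \<partial>\<mu>)"
    unfolding \<pi>'(2)[symmetric] by (simp add: nn_integral_distr)
  finally show ?thesis
    using c by (meson add_left_mono less_imp_le mult_left_mono order_trans zero_le)
qed

text \<open>\<open>borel_probs_moment\<close> provides only some centre, whereas the growth bound on
  \<open>g\<close> prescribes one.\<close>

lemma moment_finite_any_centre:
  fixes \<mu> :: "'a::{metric_space, second_countable_topology} measure"
  assumes \<mu>: "\<mu> \<in> borel_probs_moment p" and "p > 0"
  shows "(\<integral>\<^sup>+x. ennreal (dist x0 x powr p) \<partial>\<mu>) < \<infinity>"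
proof -
  obtain x1 where x1: "(\<integral>\<^sup>+x. ennreal (dist x1 x powr p) \<partial>\<mu>) < \<infinity>" and "\<mu> \<in> borel_probs"
    using \<mu> by (auto simp: borel_probs_moment_def)
  interpret prob_space \<mu> by (rule borel_probsD) fact
  note borel_probsD(1)[OF \<open>\<mu> \<in> borel_probs\<close>, measurable_cong]
  have "(\<integral>\<^sup>+x. ennreal (dist x0 x powr p) \<partial>\<mu>) \<le>
      (\<integral>\<^sup>+x. ennreal (2 powr p) * (ennreal (dist x0 x1 powr p) + ennreal (dist x1 x powr p)) \<partial>\<mu>)"
    by (intro nn_integral_mono ennreal_powr_dist_triangle \<open>p > 0\<close>)
  also have "\<dots> = ennreal (2 powr p) * (ennreal (dist x0 x1 powr p) + (\<integral>\<^sup>+x. ennreal (dist x1 x powr p) \<partial>\<mu>))"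
    by (simp add: nn_integral_cmult nn_integral_add emeasure_space_1)
  also have "\<dots> < \<infinity>" using x1 by (simp add: ennreal_mult_less_top)
  finally show ?thesis .
qed

text \<open>Fatou's lemma on the common probability space. It is applied to the transport cost, to
  the weight \<open>w\<close> and to \<open>h - g\<close>.\<close>

lemma nn_integral_law_liminf:
  fixes X :: "nat \<Rightarrow> 'a \<Rightarrow> 'v::metric_space" and \<phi> :: "'v \<Rightarrow> ennreal"
  assumes [measurable]: "\<And>n. X n \<in> borel_measurable M" "Y \<in> borel_measurable M" "\<phi> \<in> borel_measurable borel"
    and lim: "AE x in M. (\<lambda>n. X n x) \<longlonglongrightarrow> Y x"
    and lsc: "\<And>u l. u \<longlonglongrightarrow> l \<Longrightarrow> \<phi> l \<le> liminf (\<lambda>n. \<phi> (u n))"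
  shows "(\<integral>\<^sup>+v. \<phi> v \<partial>distr M borel Y) \<le> liminf (\<lambda>n. \<integral>\<^sup>+v. \<phi> v \<partial>distr M borel (X n))"
proof -
  have "(\<integral>\<^sup>+x. \<phi> (Y x) \<partial>M) \<le> (\<integral>\<^sup>+x. liminf (\<lambda>n. \<phi> (X n x)) \<partial>M)"
    using lim by (intro nn_integral_mono_AE) (auto elim!: eventually_mono intro: lsc)
  also have "\<dots> \<le> liminf (\<lambda>n. \<integral>\<^sup>+x. \<phi> (X n x) \<partial>M)"
    by (intro nn_integral_liminf) measurable
  finally show ?thesis by (simp add: nn_integral_distr)
qed

lemma continuous_le_liminf:
  assumes "continuous_on UNIV f" "u \<longlonglongrightarrow> l"
  shows "ennreal (f l) \<le> liminf (\<lambda>n. ennreal (f (u n)))"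
proof -
  have "(\<lambda>n. ennreal (f (u n))) \<longlonglongrightarrow> ennreal (f l)"
    by (intro tendsto_ennrealI continuous_on_tendsto_compose[OF assms]) auto
  then show ?thesis by (simp add: lim_imp_Liminf)
qed

text \<open>Nearly optimal couplings of \<open>\<mu>\<close> with the laws of the \<open>X n\<close>
  have bounded moments, hence are tight. A limit along a subsequence couples \<open>\<mu>\<close>
  with the law of \<open>Y\<close>, and its cost is controlled by Fatou's lemma.\<close>

lemma transport_cost_le_limit:
  fixes \<mu> :: "'v::{complete_space, second_countable_topology} measure"
  assumes proper: "\<forall>(x::'v) r. compact (cball x r)"
    and "1 \<le> p" and \<mu>: "\<mu> \<in> borel_probs_moment p"
    and "prob_space M"
    and X[measurable]: "\<And>n. X n \<in> borel_measurable M" and Y[measurable]: "Y \<in> borel_measurable M"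
    and lim: "AE x in M. (\<lambda>n. X n x) \<longlonglongrightarrow> Y x"
    and "0 \<le> d" and cost: "\<And>n. transport_cost (dist_cost p) \<mu> (distr M borel (X n)) \<le> ennreal d"
  shows "transport_cost (dist_cost p) \<mu> (distr M borel Y) \<le> ennreal d"
proof -
  have "p > 0" using \<open>1 \<le> p\<close> by simp
  define x0 :: 'v where "x0 = undefined"
  define m where "m = (\<integral>\<^sup>+x. ennreal (dist x0 x powr p) \<partial>\<mu>)"
  have m: "m < \<infinity>" unfolding m_def by (rule moment_finite_any_centre[OF \<mu> \<open>p > 0\<close>])
  have \<mu>': "\<mu> \<in> borel_probs" using \<mu> by (simp add: borel_probs_moment_def)
  note sets_\<mu>[measurable_cong] = borel_probsD(1)[OF \<mu>']
  \<comment> \<open>The slack 1/(n+1) guarantees a coupling below the bound and vanishes in the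
    limit.\<close>
  have "\<exists>\<pi>\<in>couplings \<mu> (distr M borel (X n)). (\<integral>\<^sup>+ z. ennreal (dist_cost p (fst z) (snd z)) \<partial>\<pi>) < ennreal (d + 1 / Suc n)" for n
  proof -
    have "transport_cost (dist_cost p) \<mu> (distr M borel (X n)) < ennreal (d + 1 / Suc n)"
      using \<open>0 \<le> d\<close> by (intro le_less_trans[OF cost]) (simp add: ennreal_less_iff)
    then show ?thesis using transport_cost_less_obtains by blast
  qed
  then obtain \<pi> where \<pi>: "\<And>n. \<pi> n \<in> couplings \<mu> (distr M borel (X n))"
    and \<pi>_cost: "\<And>n. (\<integral>\<^sup>+ z. ennreal (dist_cost p (fst z) (snd z)) \<partial>\<pi> n) < ennreal (d + 1 / Suc n)"
    by metis
  have \<pi>_prob: "\<pi> n \<in> borel_probs" and \<pi>_fst: "distr (\<pi> n) borel fst = \<mu>"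
    and \<pi>_snd: "distr (\<pi> n) borel snd = distr M borel (X n)" for n
    using \<pi>[of n] by (auto simp: couplings_def)
  define C where "C = 2 + (m + ennreal (2 powr p) * (m + ennreal (d + 1)))"
  have "C < \<infinity>" using m by (simp add: C_def ennreal_mult_less_top)
  have moments: "(\<integral>\<^sup>+z. ennreal (dist (x0, x0) z) \<partial>\<pi> n) \<le> C" for n
  proof -
    have "transport_cost (dist_cost p) \<mu> (distr M borel (X n)) < ennreal (d + 1)"
      using \<open>0 \<le> d\<close> by (intro le_less_trans[OF cost]) (simp add: ennreal_less_iff)
    from moment_le_of_transport_cost[OF \<open>p > 0\<close> this, of x0]
      first_moment_prod_le[OF \<pi>_prob[of n] \<open>1 \<le> p\<close> \<open>1 \<le> p\<close>, of x0 x0]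
    show ?thesis
      unfolding \<pi>_fst \<pi>_snd C_def m_def by (meson add_left_mono order_trans)
  qed
  have proper2: "\<forall>(z::'v\<times>'v) r. compact (cball z r)"
    using compact_cball_prod[OF proper proper] by blast
  have tight: "\<exists>r. \<forall>n. measure (\<pi> n) (cball (x0, x0) r) > 1 - e" if "e > 0" for e
    using tight_if_first_moments_bounded[OF \<pi>_prob moments \<open>C < \<infinity>\<close> that] .
  obtain r :: "nat \<Rightarrow> nat" and \<Omega> :: "real measure" and Z Z'
    where r: "strict_mono r" and \<Omega>: "prob_space \<Omega>"
      and Z[measurable]: "\<And>n. Z n \<in> borel_measurable \<Omega>" and Z'[measurable]: "Z' \<in> borel_measurable \<Omega>"
      and Z_law: "\<And>n. distr \<Omega> borel (Z n) = \<pi> (r n)" and Z_lim: "AE \<omega> in \<Omega>. (\<lambda>n. Z n \<omega>) \<longlonglongrightarrow> Z' \<omega>"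
    by (rule tight_convergent_representation[OF proper2 \<pi>_prob tight]) (assumption, rule that, auto)
  define \<pi>' where "\<pi>' = distr \<Omega> borel Z'"
  have "\<pi>' \<in> borel_probs" unfolding \<pi>'_def by (rule distr_in_borel_probs[OF \<Omega> Z'])
  moreover have "distr \<pi>' borel fst = \<mu>"
  proof -
    \<comment> \<open>All first coordinates have law \<open>\<mu>\<close>, so they are compared with
      the constant sequence of identity maps on \<open>\<mu>\<close> itself.\<close>
    have "distr \<Omega> borel (\<lambda>\<omega>. fst (Z' \<omega>)) = distr \<mu> borel (\<lambda>x. x)"
    proof (rule law_limit_unique[where X="\<lambda>n \<omega>. fst (Z n \<omega>)" and X'="\<lambda>n x. x"])
      show "distr \<Omega> borel (\<lambda>\<omega>. fst (Z n \<omega>)) = distr \<mu> borel (\<lambda>x. x)" for n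
        using \<pi>_fst[of "r n"] by (simp add: Z_law[symmetric] distr_distr comp_def distr_id2 sets_\<mu>)
      show "AE \<omega> in \<Omega>. (\<lambda>n. fst (Z n \<omega>)) \<longlonglongrightarrow> fst (Z' \<omega>)"
        using Z_lim by eventually_elim (rule tendsto_fst)
    qed (use \<Omega> borel_probsD(3)[OF \<mu>'] in auto)
    then show ?thesis by (simp add: \<pi>'_def distr_distr comp_def distr_id2 sets_\<mu>)
  qed
  moreover have "distr \<pi>' borel snd = distr M borel Y"
  proof -
    have "distr \<Omega> borel (\<lambda>\<omega>. snd (Z' \<omega>)) = distr M borel Y"
    proof (rule law_limit_unique[where X="\<lambda>n \<omega>. snd (Z n \<omega>)" and X'="\<lambda>n. X (r n)"])
      show "distr \<Omega> borel (\<lambda>\<omega>. snd (Z n \<omega>)) = distr M borel (X (r n))" for n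
        using \<pi>_snd[of "r n"] by (simp add: Z_law[symmetric] distr_distr comp_def)
      show "AE \<omega> in \<Omega>. (\<lambda>n. snd (Z n \<omega>)) \<longlonglongrightarrow> snd (Z' \<omega>)"
        using Z_lim by eventually_elim (rule tendsto_snd)
      show "AE x in M. (\<lambda>n. X (r n) x) \<longlonglongrightarrow> Y x"
        using lim by eventually_elim (use LIMSEQ_subseq_LIMSEQ[OF _ r] in \<open>auto simp: comp_def\<close>)
    qed (use \<Omega> \<open>prob_space M\<close> in auto)
    then show ?thesis by (simp add: \<pi>'_def distr_distr comp_def)
  qed
  ultimately have "\<pi>' \<in> couplings \<mu> (distr M borel Y)" by (simp add: couplings_def)
  then have "transport_cost (dist_cost p) \<mu> (distr M borel Y) \<le> (\<integral>\<^sup>+ z. ennreal (dist_cost p (fst z) (snd z)) \<partial>\<pi>')"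
    unfolding transport_cost_def by (rule INF_lower)
  also have "\<dots> \<le> liminf (\<lambda>n. \<integral>\<^sup>+ z. ennreal (dist_cost p (fst z) (snd z)) \<partial>\<pi> (r n))"
  proof -
    have cont: "continuous_on UNIV (\<lambda>z::'v\<times>'v. dist_cost p (fst z) (snd z))"
      unfolding dist_cost_def using \<open>p > 0\<close> by (intro continuous_intros)
    then have [measurable]: "(\<lambda>z::'v\<times>'v. dist_cost p (fst z) (snd z)) \<in> borel_measurable borel"
      by (rule borel_measurable_continuous_onI)
    show ?thesis
      unfolding \<pi>'_def Z_law[symmetric]
      by (rule nn_integral_law_liminf[OF Z Z' _ Z_lim continuous_le_liminf[OF cont]]) measurable
  qed
  also have "\<dots> \<le> liminf (\<lambda>n. ennreal (d + 1 / Suc n))"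
  proof (intro Liminf_mono always_eventually allI)
    fix n
    have "(\<integral>\<^sup>+ z. ennreal (dist_cost p (fst z) (snd z)) \<partial>\<pi> (r n)) \<le> ennreal (d + 1 / Suc (r n))"
      using \<pi>_cost[of "r n"] by simp
    also have "\<dots> \<le> ennreal (d + 1 / Suc n)"
      using seq_suble[OF r, of n] by (intro ennreal_leI add_left_mono divide_left_mono) auto
    finally show "(\<integral>\<^sup>+ z. ennreal (dist_cost p (fst z) (snd z)) \<partial>\<pi> (r n)) \<le> ennreal (d + 1 / Suc n)" .
  qed
  also have "\<dots> = ennreal d"
  proof -
    have "(\<lambda>n. ennreal (d + inverse (real (Suc n)))) \<longlonglongrightarrow> ennreal (d + 0)"
      by (intro tendsto_ennrealI tendsto_add tendsto_const LIMSEQ_inverse_real_of_nat)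
    then show ?thesis by (simp add: lim_imp_Liminf inverse_eq_divide)
  qed
  finally show ?thesis .
qed

section \<open>Upper semicontinuity of the objective\<close>

text \<open>Integrate (h - g) + g^+ = h + g^- and cancel: the integrals of \<open>h\<close> and of
  g^+ <= h are finite, while that of g^- may be infinite. The signed integral thus becomes a finite
  term minus a nonnegative integral suited to Fatou's lemma.\<close>

lemma ext_integral_dominated:
  assumes [measurable]: "h \<in> borel_measurable N" "g \<in> borel_measurable N"
    and h: "\<And>x. 0 \<le> h x" "\<And>x. g x \<le> h x" and fin: "(\<integral>\<^sup>+x. ennreal (h x) \<partial>N) < \<infinity>"
  shows "ext_integral N g = enn2ereal (\<integral>\<^sup>+x. ennreal (h x) \<partial>N) - enn2ereal (\<integral>\<^sup>+x. ennreal (h x - g x) \<partial>N)"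
proof -
  have pw: "ennreal (h x - g x) + ennreal (g x) = ennreal (h x) + ennreal (- g x)" for x
    using h[of x] by (cases "g x \<ge> 0") (auto simp: ennreal_neg simp flip: ennreal_plus)
  define A where "A = (\<integral>\<^sup>+x. ennreal (g x) \<partial>N)"
  define B where "B = (\<integral>\<^sup>+x. ennreal (- g x) \<partial>N)"
  define H where "H = (\<integral>\<^sup>+x. ennreal (h x) \<partial>N)"
  define D where "D = (\<integral>\<^sup>+x. ennreal (h x - g x) \<partial>N)"
  have "D + A = (\<integral>\<^sup>+x. ennreal (h x - g x) + ennreal (g x) \<partial>N)"
    unfolding A_def D_def by (rule nn_integral_add[symmetric]) measurable
  also have "\<dots> = H + B"
    unfolding pw B_def H_def by (rule nn_integral_add) measurable
  finally have "D + A = H + B" .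
  moreover have "H < \<infinity>" using fin by (simp add: H_def)
  moreover have "A \<le> H" unfolding A_def H_def by (intro nn_integral_mono ennreal_leI h)
  ultimately have "enn2ereal A - enn2ereal B = enn2ereal H - enn2ereal D"
    by (cases A; cases B; cases H; cases D) (auto simp: enn2ereal_ennreal ennreal_plus[symmetric] top_unique simp del: ennreal_plus)
  then show ?thesis by (simp add: ext_integral_def A_def B_def H_def D_def)
qed

lemma upper_semicontinuous_sequentially:
  assumes "upper_semicontinuous g" "u \<longlonglongrightarrow> l" "g l < a"
  shows "\<forall>\<^sub>F n in sequentially. g (u n) < a"
proof -
  have "\<forall>\<^sub>F y in nhds l. g y < a"
    using assms(1,3) unfolding upper_semicontinuous_def by blast
  then show ?thesis by (rule eventually_compose_filterlim[OF _ assms(2)])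
qed

lemma diff_usc_le_liminf:
  assumes h: "continuous_on UNIV h" and g: "upper_semicontinuous g" and u: "u \<longlonglongrightarrow> l"
  shows "ennreal (h l - g l) \<le> liminf (\<lambda>n. ennreal (h (u n) - g (u n)))"
  unfolding le_Liminf_iff
proof (intro allI impI)
  fix y assume y: "y < ennreal (h l - g l)"
  then obtain y' where y': "y = ennreal y'" "0 \<le> y'" by (cases y) auto
  then have "y' < h l - g l" using y by (simp add: ennreal_less_iff)
  \<comment> \<open>Half of the gap pays for the variation of \<open>h\<close>, half for that of
    \<open>g\<close>.\<close>
  define e where "e = (h l - g l - y') / 2"
  have "e > 0" using \<open>y' < h l - g l\<close> by (simp add: e_def)
  have "(\<lambda>n. h (u n)) \<longlonglongrightarrow> h l" by (intro continuous_on_tendsto_compose[OF h u]) auto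
  then have "\<forall>\<^sub>F n in sequentially. h l - e < h (u n)"
    by (rule order_tendstoD) (use \<open>e > 0\<close> in simp)
  moreover have "\<forall>\<^sub>F n in sequentially. g (u n) < g l + e"
    by (rule upper_semicontinuous_sequentially[OF g u]) (use \<open>e > 0\<close> in simp)
  ultimately show "\<forall>\<^sub>F n in sequentially. y < ennreal (h (u n) - g (u n))"
  proof eventually_elim
    case (elim n)
    then have "y' < h (u n) - g (u n)" by (simp add: e_def field_simps)
    then show ?case using y' by (simp add: ennreal_less_iff)
  qed
qed

text \<open>Fatou's lemma is applied to \<open>K + e * w - g\<close>, which is nonnegative and lower semicontinuous; the
  bound on the integrals of \<open>w\<close> makes the error of size \<open>e * C\<close>.\<close>

lemma ext_integral_limit_ge:
  fixes X :: "nat \<Rightarrow> 'a \<Rightarrow> 'v::metric_space"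
  assumes "prob_space M"
    and X[measurable]: "\<And>n. X n \<in> borel_measurable M" and Y[measurable]: "Y \<in> borel_measurable M"
    and lim: "AE x in M. (\<lambda>n. X n x) \<longlonglongrightarrow> Y x"
    and g[measurable]: "g \<in> borel_measurable borel" and usc: "upper_semicontinuous g"
    and w: "continuous_on UNIV w" "\<And>v. 0 \<le> w v"
    and growth: "\<And>e. e > 0 \<Longrightarrow> \<exists>K\<ge>0. \<forall>v. g v \<le> K + e * w v"
    and "0 \<le> C" and bound: "\<And>n. (\<integral>\<^sup>+v. ennreal (w v) \<partial>distr M borel (X n)) \<le> ennreal C"
    and S: "(\<lambda>n. ext_integral (distr M borel (X n)) g) \<longlonglongrightarrow> S"
  shows "S \<le> ext_integral (distr M borel Y) g"
proof -
  define N where "N n = distr M borel (X n)" for n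
  define N' where "N' = distr M borel Y"
  have prob: "prob_space (N n)" "prob_space N'" for n
    by (auto simp: N_def N'_def intro!: prob_space.prob_space_distr \<open>prob_space M\<close>)
  have sets_N[measurable_cong]: "sets (N n) = sets borel" "sets N' = sets borel" for n
    by (simp_all add: N_def N'_def)
  have w_meas[measurable]: "w \<in> borel_measurable borel"
    by (rule borel_measurable_continuous_onI[OF w(1)])
  have "(\<integral>\<^sup>+v. ennreal (w v) \<partial>N') \<le> liminf (\<lambda>n. \<integral>\<^sup>+v. ennreal (w v) \<partial>N n)"
    unfolding N_def N'_def
    by (rule nn_integral_law_liminf[OF X Y _ lim continuous_le_liminf[OF w(1)]]) measurable
  also have "\<dots> \<le> liminf (\<lambda>n. ennreal C)"
    using bound by (intro Liminf_mono always_eventually) (auto simp: N_def)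
  finally have bound': "(\<integral>\<^sup>+v. ennreal (w v) \<partial>N') \<le> ennreal C" by (simp add: Liminf_const)
  have key: "ereal (a - e * C) \<le> ext_integral N' g" if a: "ereal a < S" and e: "e > 0" for a e
  proof -
    obtain K where K: "K \<ge> 0" "\<And>v. g v \<le> K + e * w v" using growth[OF e] by blast
    have KC: "0 \<le> K + e * C" using K e \<open>0 \<le> C\<close> by simp
    define h where "h v = K + e * w v" for v
    have h: "continuous_on UNIV h" "\<And>v. K \<le> h v" "\<And>v. 0 \<le> h v" "\<And>v. g v \<le> h v"
      unfolding h_def using K e w(2) by (auto intro!: continuous_intros w(1))
    have [measurable]: "h \<in> borel_measurable borel"
      by (rule borel_measurable_continuous_onI[OF h(1)])
    \<comment> \<open>The integral of \<open>h\<close> is known up to an interval of length e * C,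
      which is exactly the loss in \<open>key\<close>.\<close>
    have h_int: "ennreal K \<le> (\<integral>\<^sup>+v. ennreal (h v) \<partial>L)" "(\<integral>\<^sup>+v. ennreal (h v) \<partial>L) \<le> ennreal (K + e * C)"
      if L: "prob_space L" "sets L = sets borel" "(\<integral>\<^sup>+v. ennreal (w v) \<partial>L) \<le> ennreal C" for L
    proof -
      interpret L: prob_space L by fact
      note L(2)[measurable_cong]
      have "ennreal K = (\<integral>\<^sup>+v. ennreal K \<partial>L)" by (simp add: L.emeasure_space_1)
      also have "\<dots> \<le> (\<integral>\<^sup>+v. ennreal (h v) \<partial>L)" by (intro nn_integral_mono ennreal_leI h)
      finally show "ennreal K \<le> (\<integral>\<^sup>+v. ennreal (h v) \<partial>L)" .
      have "(\<integral>\<^sup>+v. ennreal (h v) \<partial>L) = (\<integral>\<^sup>+v. ennreal K + ennreal e * ennreal (w v) \<partial>L)"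
        using K e w(2) by (intro nn_integral_cong) (simp add: h_def ennreal_mult)
      also have "\<dots> = ennreal K + ennreal e * (\<integral>\<^sup>+v. ennreal (w v) \<partial>L)"
        by (simp add: nn_integral_add nn_integral_cmult L.emeasure_space_1)
      also have "\<dots> \<le> ennreal K + ennreal e * ennreal C"
        by (intro add_left_mono mult_left_mono L) auto
      also have "\<dots> = ennreal (K + e * C)" using K e \<open>0 \<le> C\<close> by (simp add: ennreal_mult)
      finally show "(\<integral>\<^sup>+v. ennreal (h v) \<partial>L) \<le> ennreal (K + e * C)" .
    qed
    have ext: "ext_integral L g = enn2ereal (\<integral>\<^sup>+v. ennreal (h v) \<partial>L) - enn2ereal (\<integral>\<^sup>+v. ennreal (h v - g v) \<partial>L)"
      if L: "prob_space L" "sets L = sets borel" "(\<integral>\<^sup>+v. ennreal (w v) \<partial>L) \<le> ennreal C" for L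
    proof (rule ext_integral_dominated)
      note L(2)[measurable_cong]
      show "h \<in> borel_measurable L" "g \<in> borel_measurable L" by measurable
      show "(\<integral>\<^sup>+v. ennreal (h v) \<partial>L) < \<infinity>"
        using h_int(2)[OF L] by (auto intro: le_less_trans)
    qed (use h in auto)
    have "\<forall>\<^sub>F n in sequentially. ereal a < ext_integral (N n) g"
      using order_tendstoD(1)[OF S a] by (simp add: N_def)
    \<comment> \<open>Obtained from a < H - D and H <= K + e * C. Nonnegativity is recorded because
      \<open>ennreal\<close> would turn a negative bound into 0.\<close>
    then have ev: "\<forall>\<^sub>F n in sequentially. (\<integral>\<^sup>+v. ennreal (h v - g v) \<partial>N n) \<le> ennreal (K + e * C - a) \<and> 0 \<le> K + e * C - a"
    proof eventually_elim
      case (elim n)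
      have L: "prob_space (N n)" "sets (N n) = sets borel" "(\<integral>\<^sup>+v. ennreal (w v) \<partial>N n) \<le> ennreal C"
        using prob sets_N bound by (auto simp: N_def)
      define H where "H = (\<integral>\<^sup>+v. ennreal (h v) \<partial>N n)"
      define D where "D = (\<integral>\<^sup>+v. ennreal (h v - g v) \<partial>N n)"
      have "ereal a < enn2ereal H - enn2ereal D" using elim ext[OF L] by (simp add: H_def D_def)
      moreover have "H \<le> ennreal (K + e * C)" using h_int(2)[OF L] by (simp add: H_def)
      ultimately have "D \<le> ennreal (K + e * C - a) \<and> 0 \<le> K + e * C - a"
        using KC
        by (cases H; cases D)
           (auto simp: enn2ereal_ennreal top_unique simp del: ennreal_plus intro!: ennreal_leI)
      then show ?case by (simp add: D_def)
    qed
    then have nonneg: "0 \<le> K + e * C - a" using eventually_happens by force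
    have L: "prob_space N'" "sets N' = sets borel" "(\<integral>\<^sup>+v. ennreal (w v) \<partial>N') \<le> ennreal C"
      using prob sets_N bound' by auto
    define H where "H = (\<integral>\<^sup>+v. ennreal (h v) \<partial>N')"
    define D where "D = (\<integral>\<^sup>+v. ennreal (h v - g v) \<partial>N')"
    have "D \<le> liminf (\<lambda>n. \<integral>\<^sup>+v. ennreal (h v - g v) \<partial>N n)"
      unfolding D_def N_def N'_def
      by (rule nn_integral_law_liminf[OF X Y _ lim diff_usc_le_liminf[OF h(1) usc]]) measurable
    also have "\<dots> \<le> liminf (\<lambda>n. ennreal (K + e * C - a))"
      by (rule Liminf_mono) (use ev in \<open>auto elim: eventually_mono\<close>)
    finally have D: "D \<le> ennreal (K + e * C - a)" by (simp add: Liminf_const)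
    have H: "ennreal K \<le> H" "H \<le> ennreal (K + e * C)" using h_int[OF L] by (auto simp: H_def)
    \<comment> \<open>Here H >= K and D <= K + e * C - a, so \<open>K\<close> cancels; no limit of
      the integrals of \<open>h\<close> has to be identified.\<close>
    have "ereal (a - e * C) \<le> enn2ereal H - enn2ereal D"
      using D H K(1) KC nonneg
      by (cases H; cases D) (auto simp: enn2ereal_ennreal top_unique simp del: ennreal_plus)
    then show ?thesis using ext[OF L] by (simp add: H_def D_def)
  qed
  \<comment> \<open>\<open>S\<close> may be infinite, so the comparison is made with real numbers
    below \<open>S\<close>.\<close>
  have "ereal a \<le> ext_integral N' g" if a: "ereal a < S" for a
  proof (rule ereal_le_epsilon2)
    fix e :: real assume "e > 0"
    \<comment> \<open>The denominator C + 1 also covers C = 0.\<close>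
    define e' where "e' = e / (C + 1)"
    have "e' > 0" "e' * C \<le> e" using \<open>e > 0\<close> \<open>0 \<le> C\<close> by (auto simp: e'_def field_simps)
    have "ereal a - ereal e \<le> ereal (a - e' * C)" using \<open>e' * C \<le> e\<close> by simp
    also have "\<dots> \<le> ext_integral N' g" by (rule key[OF a \<open>e' > 0\<close>])
    finally show "ereal a \<le> ext_integral N' g + ereal e"
      by (cases "ext_integral N' g") auto
  qed
  then have "x \<le> ext_integral N' g" if "x < S" for x
    using that by (cases x) auto
  then show ?thesis unfolding N'_def by (rule dense_le)
qed

section \<open>Feasibility and existence of a maximizer\<close>

lemma transport_cost_self:
  fixes \<mu> :: "'a::{metric_space, second_countable_topology} measure"
  assumes \<mu>: "\<mu> \<in> borel_probs" and "p > 0"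
  shows "transport_cost (dist_cost p) \<mu> \<mu> = 0"
proof -
  note sets_\<mu>[measurable_cong] = borel_probsD(1)[OF \<mu>]
  define \<pi> where "\<pi> = distr \<mu> borel (\<lambda>x. (x, x))"
  have d[measurable]: "(\<lambda>x::'a. (x, x)) \<in> borel_measurable borel"
    by (intro borel_measurable_continuous_onI continuous_intros)
  have "\<pi> \<in> couplings \<mu> \<mu>"
    unfolding couplings_def \<pi>_def
    using distr_in_borel_probs[OF borel_probsD(3)[OF \<mu>], of "\<lambda>x. (x, x)"]
    by (simp add: distr_distr comp_def distr_id2 sets_\<mu>)
  moreover have "(\<integral>\<^sup>+z. ennreal (dist_cost p (fst z) (snd z)) \<partial>\<pi>) = 0"
  proof -
    have "(\<lambda>z::'a \<times> 'a. dist_cost p (fst z) (snd z)) \<in> borel_measurable borel"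
      unfolding dist_cost_def using \<open>p > 0\<close> by (intro borel_measurable_continuous_onI continuous_intros)
    then have "(\<integral>\<^sup>+z. ennreal (dist_cost p (fst z) (snd z)) \<partial>\<pi>) = (\<integral>\<^sup>+x. ennreal (dist_cost p x x) \<partial>\<mu>)"
      unfolding \<pi>_def by (subst nn_integral_distr) auto
    then show ?thesis by (simp add: dist_cost_def)
  qed
  ultimately have "transport_cost (dist_cost p) \<mu> \<mu> \<le> 0"
    unfolding transport_cost_def by (metis (no_types, lifting) INF_lower)
  then show ?thesis by simp
qed

theorem theorem4p3:
  fixes \<mu>1 :: "('a::polish_space) measure"
    and \<mu>2 :: "('b::polish_space) measure"
    and p1 p2 p1' p2' M :: real
    and g :: "'a \<times> 'b \<Rightarrow> real"
    and vstar :: "'a \<times> 'b"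
  assumes proper1: "\<forall>(x::'a) r. compact (cball x r)"
    and proper2: "\<forall>(x::'b) r. compact (cball x r)"
    and p1: "1 \<le> p1" and p2: "1 \<le> p2"
    and \<mu>1: "\<mu>1 \<in> borel_probs_moment p1"
    and \<mu>2: "\<mu>2 \<in> borel_probs_moment p2"
    and g_meas: "g \<in> borel_measurable borel"
    and g_int: "\<exists>\<gamma>0 \<in> couplings \<mu>1 \<mu>2. ext_integral \<gamma>0 g > -\<infinity>"
    and g_usc: "upper_semicontinuous g"
    and M: "0 < M"
    and p1': "0 < p1'" "p1' < p1"
    and p2': "0 < p2'" "p2' < p2"
    and growth: "\<forall>s1 s2. g (s1, s2) \<le>
        M * (1 + dist (fst vstar) s1 powr p1' + dist (snd vstar) s2 powr p2')"
  shows "\<forall>\<delta> :: real ^ 2. (\<forall>i. 0 \<le> \<delta> $ i) \<longrightarrow>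
    (\<exists>\<gamma> \<in> Sigma_D (dist_cost p1) (dist_cost p2) \<mu>1 \<mu>2 \<delta>.
       ext_integral \<gamma> g =
         (SUP \<gamma>' \<in> Sigma_D (dist_cost p1) (dist_cost p2) \<mu>1 \<mu>2 \<delta>. ext_integral \<gamma>' g))"
proof (intro allI impI)
  fix \<delta> :: "real ^ 2" assume "\<forall>i. 0 \<le> \<delta> $ i"
  then have \<delta>: "0 \<le> \<delta> $ i" for i by blast
  define \<Sigma> where "\<Sigma> = Sigma_D (dist_cost p1) (dist_cost p2) \<mu>1 \<mu>2 \<delta>"
  obtain s1 s2 where vstar: "vstar = (s1, s2)" by (cases vstar)
  have pos: "p1 > 0" "p2 > 0" using p1 p2 by auto
  have \<mu>_prob: "\<mu>1 \<in> borel_probs" "\<mu>2 \<in> borel_probs" using \<mu>1 \<mu>2 by (auto simp: borel_probs_moment_def)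
  have \<Sigma>D: "\<gamma> \<in> borel_probs" "transport_cost (dist_cost p1) \<mu>1 (distr \<gamma> borel fst) \<le> ennreal (\<delta> $ 1)"
    "transport_cost (dist_cost p2) \<mu>2 (distr \<gamma> borel snd) \<le> ennreal (\<delta> $ 2)" if "\<gamma> \<in> \<Sigma>" for \<gamma>
    using that by (auto simp: \<Sigma>_def Sigma_D_def)
  have "\<Sigma> \<noteq> {}"
  proof -
    obtain \<gamma>0 where "\<gamma>0 \<in> couplings \<mu>1 \<mu>2" using g_int by blast
    \<comment> \<open>The marginals of a coupling of \<open>\<mu>1\<close> and \<open>\<mu>2\<close>
      have transport cost 0 from them, so it is feasible for every nonnegative
      \<open>\<delta>\<close>.\<close>
    then have "\<gamma>0 \<in> \<Sigma>"
      by (simp add: \<Sigma>_def Sigma_D_def couplings_def transport_cost_self \<mu>_prob pos)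
    then show ?thesis by blast
  qed
  then obtain F where F: "incseq F" "range F \<subseteq> (\<lambda>\<gamma>. ext_integral \<gamma> g) ` \<Sigma>"
    and F_sup: "(SUP \<gamma>\<in>\<Sigma>. ext_integral \<gamma> g) = (SUP n. F n)"
    using Sup_countable_SUP[of "(\<lambda>\<gamma>. ext_integral \<gamma> g) ` \<Sigma>"] by auto
  have "\<exists>\<gamma>\<in>\<Sigma>. ext_integral \<gamma> g = F n" for n
    using subsetD[OF F(2), OF rangeI[of F n]] by force
  then obtain \<gamma> where \<gamma>: "\<And>n. \<gamma> n \<in> \<Sigma>" and \<gamma>_ext: "\<And>n. ext_integral (\<gamma> n) g = F n" by metis
  note \<gamma>_prob = \<Sigma>D(1)[OF \<gamma>]
  have F_lim: "F \<longlonglongrightarrow> (SUP \<gamma>\<in>\<Sigma>. ext_integral \<gamma> g)"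
    unfolding F_sup by (rule LIMSEQ_SUP[OF F(1)])

  \<comment> \<open>The weight has integrals bounded along the maximizing sequence, and
    \<open>g\<close> is at most e * w plus a constant for every e > 0.\<close>
  define w where "w z = dist s1 (fst z) powr p1 + dist s2 (snd z) powr p2" for z :: "'a \<times> 'b"
  have w_cont: "continuous_on UNIV w"
    unfolding w_def by (intro continuous_intros pos)
  \<comment> \<open>The added 1 turns the constraint with bound \<open>\<delta>\<close> into the
    strict inequality that \<open>moment_le_of_transport_cost\<close> asks for.\<close>
  define C1 where "C1 = ennreal (2 powr p1) * ((\<integral>\<^sup>+x. ennreal (dist s1 x powr p1) \<partial>\<mu>1) + ennreal (\<delta> $ 1 + 1))"
  define C2 where "C2 = ennreal (2 powr p2) * ((\<integral>\<^sup>+x. ennreal (dist s2 x powr p2) \<partial>\<mu>2) + ennreal (\<delta> $ 2 + 1))"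
  have "C1 + C2 < \<infinity>"
    using moment_finite_any_centre[OF \<mu>1 pos(1), of s1] moment_finite_any_centre[OF \<mu>2 pos(2), of s2]
    by (simp add: C1_def C2_def ennreal_mult_less_top)
  have C1: "(\<integral>\<^sup>+x. ennreal (dist s1 x powr p1) \<partial>distr (\<gamma> n) borel fst) \<le> C1" for n
    unfolding C1_def
    by (intro moment_le_of_transport_cost pos le_less_trans[OF \<Sigma>D(2)[OF \<gamma>]])
       (use \<delta> in \<open>simp add: ennreal_less_iff\<close>)
  have C2: "(\<integral>\<^sup>+x. ennreal (dist s2 x powr p2) \<partial>distr (\<gamma> n) borel snd) \<le> C2" for n
    unfolding C2_def
    by (intro moment_le_of_transport_cost pos le_less_trans[OF \<Sigma>D(3)[OF \<gamma>]])
       (use \<delta> in \<open>simp add: ennreal_less_iff\<close>)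
  obtain C where C: "C1 + C2 = ennreal C" "0 \<le> C"
    using \<open>C1 + C2 < \<infinity>\<close> by (cases "C1 + C2") auto
  have w_bound: "(\<integral>\<^sup>+z. ennreal (w z) \<partial>\<gamma> n) \<le> ennreal C" for n
  proof -
    note borel_probsD(1)[OF \<gamma>_prob, of n, measurable_cong]
    have "(\<integral>\<^sup>+z. ennreal (w z) \<partial>\<gamma> n) =
        (\<integral>\<^sup>+z. ennreal (dist s1 (fst z) powr p1) \<partial>\<gamma> n) + (\<integral>\<^sup>+z. ennreal (dist s2 (snd z) powr p2) \<partial>\<gamma> n)"
      by (simp add: w_def nn_integral_add)
    then show ?thesis
      using add_mono[OF C1[of n] C2[of n]] C by (simp add: nn_integral_distr)
  qed
  have proper: "\<forall>(z::'a\<times>'b) r. compact (cball z r)"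
    using compact_cball_prod[OF proper1 proper2] by blast
  have moments: "(\<integral>\<^sup>+z. ennreal (dist (s1, s2) z) \<partial>\<gamma> n) \<le> 2 + ennreal C" for n
    unfolding C(1)[symmetric]
    by (rule order_trans[OF first_moment_prod_le[OF \<gamma>_prob p1 p2]]) (intro add_left_mono add_mono C1 C2)
  have "2 + ennreal C < \<infinity>" by simp
  have tight: "\<exists>r. \<forall>n. measure (\<gamma> n) (cball (s1, s2) r) > 1 - e" if "e > 0" for e
    using tight_if_first_moments_bounded[OF \<gamma>_prob moments \<open>2 + ennreal C < \<infinity>\<close> that] .
  obtain r :: "nat \<Rightarrow> nat" and \<Omega> :: "real measure" and X Y
    where r: "strict_mono r" and \<Omega>: "prob_space \<Omega>"
      and X[measurable]: "\<And>n. X n \<in> borel_measurable \<Omega>" and Y[measurable]: "Y \<in> borel_measurable \<Omega>"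
      and law: "\<And>n. distr \<Omega> borel (X n) = \<gamma> (r n)" and lim: "AE \<omega> in \<Omega>. (\<lambda>n. X n \<omega>) \<longlonglongrightarrow> Y \<omega>"
    by (rule tight_convergent_representation[OF proper \<gamma>_prob tight]) (assumption, rule that, auto)
  define \<gamma>' where "\<gamma>' = distr \<Omega> borel Y"

  have "transport_cost (dist_cost p1) \<mu>1 (distr \<Omega> borel (\<lambda>\<omega>. fst (Y \<omega>))) \<le> ennreal (\<delta> $ 1)"
  proof (rule transport_cost_le_limit[OF proper1 p1 \<mu>1 \<Omega>, where X="\<lambda>n \<omega>. fst (X n \<omega>)"])
    show "AE \<omega> in \<Omega>. (\<lambda>n. fst (X n \<omega>)) \<longlonglongrightarrow> fst (Y \<omega>)"
      using lim by eventually_elim (rule tendsto_fst)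
    show "transport_cost (dist_cost p1) \<mu>1 (distr \<Omega> borel (\<lambda>\<omega>. fst (X n \<omega>))) \<le> ennreal (\<delta> $ 1)" for n
      using \<Sigma>D(2)[OF \<gamma>[of "r n"]] by (simp add: law[symmetric] distr_distr comp_def)
  qed (use \<delta> in auto)
  moreover have "transport_cost (dist_cost p2) \<mu>2 (distr \<Omega> borel (\<lambda>\<omega>. snd (Y \<omega>))) \<le> ennreal (\<delta> $ 2)"
  proof (rule transport_cost_le_limit[OF proper2 p2 \<mu>2 \<Omega>, where X="\<lambda>n \<omega>. snd (X n \<omega>)"])
    show "AE \<omega> in \<Omega>. (\<lambda>n. snd (X n \<omega>)) \<longlonglongrightarrow> snd (Y \<omega>)"
      using lim by eventually_elim (rule tendsto_snd)
    show "transport_cost (dist_cost p2) \<mu>2 (distr \<Omega> borel (\<lambda>\<omega>. snd (X n \<omega>))) \<le> ennreal (\<delta> $ 2)" for n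
      using \<Sigma>D(3)[OF \<gamma>[of "r n"]] by (simp add: law[symmetric] distr_distr comp_def)
  qed (use \<delta> in auto)
  ultimately have "\<gamma>' \<in> \<Sigma>"
    using distr_in_borel_probs[OF \<Omega> Y] by (simp add: \<gamma>'_def \<Sigma>_def Sigma_D_def distr_distr comp_def)
  \<comment> \<open>The values along the subsequence converge to the supremum, so upper
    semicontinuity along \<open>X\<close> shows that the limit law reaches it.\<close>
  have "(SUP \<gamma>\<in>\<Sigma>. ext_integral \<gamma> g) \<le> ext_integral \<gamma>' g"
    unfolding \<gamma>'_def
  proof (rule ext_integral_limit_ge[OF \<Omega> X Y lim g_meas g_usc w_cont])
    show "0 \<le> w v" for v by (simp add: w_def)
    show "(\<integral>\<^sup>+v. ennreal (w v) \<partial>distr \<Omega> borel (X n)) \<le> ennreal C" for n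
      unfolding law by (rule w_bound)
    show "(\<lambda>n. ext_integral (distr \<Omega> borel (X n)) g) \<longlonglongrightarrow> (SUP \<gamma>\<in>\<Sigma>. ext_integral \<gamma> g)"
      using LIMSEQ_subseq_LIMSEQ[OF F_lim r] by (simp add: law \<gamma>_ext comp_def)
    fix e :: real assume "e > 0"
    \<comment> \<open>The constants of \<open>powr_le_eps\<close> for e/M: the factor
      \<open>M\<close> in the growth bound then restores exactly e * w.\<close>
    define K1 where "K1 = (e / M) powr (- p1' / (p1 - p1'))"
    define K2 where "K2 = (e / M) powr (- p2' / (p2 - p2'))"
    have "g v \<le> M * (1 + K1 + K2) + e * w v" for v
    proof -
      have "g v \<le> M * (1 + dist s1 (fst v) powr p1' + dist s2 (snd v) powr p2')"
        using growth[rule_format, of "fst v" "snd v"] by (simp add: vstar)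
      also have "\<dots> \<le> M * (1 + (K1 + e / M * dist s1 (fst v) powr p1) + (K2 + e / M * dist s2 (snd v) powr p2))"
        using M \<open>e > 0\<close> p1' p2' unfolding K1_def K2_def
        by (intro mult_left_mono add_mono powr_le_eps) auto
      also have "\<dots> = M * (1 + K1 + K2) + e * w v"
        using M by (simp add: w_def field_simps)
      finally show ?thesis .
    qed
    moreover have "0 \<le> M * (1 + K1 + K2)" using M by (simp add: K1_def K2_def)
    ultimately show "\<exists>K\<ge>0. \<forall>v. g v \<le> K + e * w v" by blast
  qed (rule C(2))
  then have "ext_integral \<gamma>' g = (SUP \<gamma>\<in>\<Sigma>. ext_integral \<gamma> g)"
    using \<open>\<gamma>' \<in> \<Sigma>\<close> by (intro antisym SUP_upper)
  then show "\<exists>\<gamma> \<in> Sigma_D (dist_cost p1) (dist_cost p2) \<mu>1 \<mu>2 \<delta>. ext_integral \<gamma> g =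
      (SUP \<gamma>' \<in> Sigma_D (dist_cost p1) (dist_cost p2) \<mu>1 \<mu>2 \<delta>. ext_integral \<gamma>' g)"
    using \<open>\<gamma>' \<in> \<Sigma>\<close> unfolding \<Sigma>_def by blast
qed

end
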